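(* Let $\{S_i\}_{i\in\mathcal{I}}$ be an IFS with attractor $K$ and associated self-similar measure $\mu_{\mathbf p}$. Suppose $\Delta_1,\Delta_2$ are net intervals with $\mathcal V(\Delta_1)=\mathcal V(\Delta_2)$. Then there exist a surjective similarity $g:\Delta_1\cap K\to\Delta_2\cap K$ and constants $c_1,c_2>0$ such that if $E\subseteq\Delta_1$ is any Borel set, $$c_1\mu_{\mathbf p}(E)\le\mu_{\mathbf p}(g(E\cap K))\le c_2\mu_{\mathbf p}(E).$$
   Context: IFS. An iterated function system of similarities (IFS) is a finite set of maps $S_i(x)=r_ix+d_i$ on $\mathbb{R}$, $i\in\mathcal{I}$, with $0<|r_i|<1$ and $\#\mathcal{I}\ge 2$. Its attractor $K$ is the unique non-empty compact set with $K=\bigcup_{i}S_i(K)$. Standing assumptions: $K$ is not a singleton and (normalization) the convex hull of $K$ is $[0,1]$. Given $\mathbf p=(p_i)_{i\in\mathcal I}$ with $p_i>0$, $\sum p_i=1$, the associated self-similar measure $\mu_{\mathbf p}$ is the unique Borel probability measure with $\mu_{\mathbf p}(E)=\sum_i p_i\mu_{\mathbf p}(S_i^{-1}(E))$ for all Borel $E$. $\mathcal{I}^*$ is the set of finite words; for $\sigma=(\sigma_1,\dots,\sigma_n)$, $S_\sigma=S_{\sigma_1}\circ\cdots\circ S_{\sigma_n}$, $r_\sigma=\prod r_{\sigma_k}$, and $\sigma^-$ is $\sigma$ with the last letter deleted; for the empty word $S_\emptyset=\mathrm{id}$, $r_\emptyset=1$. For $t>0$, $\Lambda_t=\{\sigma\in\mathcal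 I^*:|r_\sigma|<t\le|r_{\sigma^-}|\}$ (convention: $|r_{\emptyset^-}|=\infty$, so $\Lambda_t=\{\emptyset\}$ for $t>1$). Net intervals. For $t>0$ let $h_1<\dots<h_{s(t)}$ be the distinct elements of $\{S_\sigma(0),S_\sigma(1):\sigma\in\Lambda_t\}$. The net intervals of generation $t$ are the elements of $\mathcal{F}_t=\{[h_j,h_{j+1}]:1\le j<s(t),\ (h_j,h_{j+1})\cap K\ne\emptyset\}$. A net interval is always considered together with its generation; $\Delta_1$ and $\Delta_2$ may have different generations. $T_\Delta(x)=rx+a$ is the map with $r>0$ and $T_\Delta([0,1])=\Delta$. The neighbour set of $\Delta\in\mathcal F_t$ is $\mathcal V(\Delta)=\mathcal{V}_t(\Delta)=\{T_\Delta^{-1}\circ S_\sigma:\sigma\in\Lambda_t,\ S_\sigma(K)\cap\Delta^\circ\neq\emptyset\}$ (a set of functions). A similarity is a map $g$ with $|g(x)-g(y)|=c|x-y|$ for some fixed $c>0$. *)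

theory Defs
  imports "HOL-Probability.Probability"
begin

text \<open>The maps are an indexed family, as \<open>p\<close> and the words refer to indices; two indices
  may carry the same map.\<close>

definition ifs_map :: "('i \<Rightarrow> real) \<Rightarrow> ('i \<Rightarrow> real) \<Rightarrow> 'i \<Rightarrow> real \<Rightarrow> real" where
  "ifs_map r d i = (\<lambda>x. r i * x + d i)"

definition is_ifs :: "'i set \<Rightarrow> ('i \<Rightarrow> real) \<Rightarrow> bool" where
  "is_ifs I r \<longleftrightarrow> finite I \<and> 2 \<le> card I \<and> (\<forall>i\<in>I. 0 < \<bar>r i\<bar> \<and> \<bar>r i\<bar> < 1)"

definition is_attractor :: "'i set \<Rightarrow> ('i \<Rightarrow> real) \<Rightarrow> ('i \<Rightarrow> real) \<Rightarrow> real set \<Rightarrow> bool" where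
  "is_attractor I r d K \<longleftrightarrow> K \<noteq> {} \<and> compact K \<and> K = (\<Union>i\<in>I. ifs_map r d i ` K)"

definition is_prob_vector :: "'i set \<Rightarrow> ('i \<Rightarrow> real) \<Rightarrow> bool" where
  "is_prob_vector I p \<longleftrightarrow> (\<forall>i\<in>I. 0 < p i) \<and> (\<Sum>i\<in>I. p i) = 1"

definition is_self_similar_measure ::
    "'i set \<Rightarrow> ('i \<Rightarrow> real) \<Rightarrow> ('i \<Rightarrow> real) \<Rightarrow> ('i \<Rightarrow> real) \<Rightarrow> real measure \<Rightarrow> bool" where
  "is_self_similar_measure I r d p \<mu> \<longleftrightarrow>
     prob_space \<mu> \<and> sets \<mu> = sets borel \<and>
     (\<forall>E\<in>sets borel. measure \<mu> E = (\<Sum>i\<in>I. p i * measure \<mu> (ifs_map r d i -` E)))"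

definition word_map :: "('i \<Rightarrow> real) \<Rightarrow> ('i \<Rightarrow> real) \<Rightarrow> 'i list \<Rightarrow> real \<Rightarrow> real" where
  "word_map r d \<sigma> = foldr (\<lambda>i f. ifs_map r d i \<circ> f) \<sigma> id"

definition word_ratio :: "('i \<Rightarrow> real) \<Rightarrow> 'i list \<Rightarrow> real" where
  "word_ratio r \<sigma> = prod_list (map r \<sigma>)"

text \<open>The disjunct \<open>\<sigma> = []\<close> encodes the convention that the ratio of the deleted
  empty word is infinite.\<close>

definition stopping_words :: "'i set \<Rightarrow> ('i \<Rightarrow> real) \<Rightarrow> real \<Rightarrow> 'i list set" where
  "stopping_words I r t =
     {\<sigma> \<in> lists I. \<bar>word_ratio r \<sigma>\<bar> < t \<and> (\<sigma> = [] \<or> t \<le> \<bar>word_ratio r (butlast \<sigma>)\<bar>)}"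

definition net_points ::
    "'i set \<Rightarrow> ('i \<Rightarrow> real) \<Rightarrow> ('i \<Rightarrow> real) \<Rightarrow> real \<Rightarrow> real set" where
  "net_points I r d t = (\<Union>\<sigma>\<in>stopping_words I r t. {word_map r d \<sigma> 0, word_map r d \<sigma> 1})"

text \<open>The third conjunct says that \<open>a < b\<close> are consecutive elements of
  \<^const>\<open>net_points\<close>.\<close>

definition net_intervals ::
    "'i set \<Rightarrow> ('i \<Rightarrow> real) \<Rightarrow> ('i \<Rightarrow> real) \<Rightarrow> real set \<Rightarrow> real \<Rightarrow> real set set" where
  "net_intervals I r d K t =
     {{a..b} | a b. a \<in> net_points I r d t \<and> b \<in> net_points I r d t \<and>
        a < b \<and> {a<..<b} \<inter> net_points I r d t = {} \<and> {a<..<b} \<inter> K \<noteq> {}}"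

definition interval_map :: "real set \<Rightarrow> real \<Rightarrow> real" where
  "interval_map \<Delta> = (\<lambda>x. (Sup \<Delta> - Inf \<Delta>) * x + Inf \<Delta>)"

lemma interval_map_unique:
  fixes a b c e :: real
  assumes "a < b"
  shows "(0 < c \<and> (\<lambda>x. c * x + e) ` {0..1} = {a..b}) \<longleftrightarrow> (\<lambda>x. c * x + e) = interval_map {a..b}"
proof -
  have T: "interval_map {a..b} = (\<lambda>x. (b - a) * x + a)"
    using assms by (simp add: interval_map_def)
  have im: "(\<lambda>x. c * x + e) ` {0..1} = {e..c + e}" if "0 < c" for c e :: real
    using that image_affinity_atLeastAtMost[of c e 0 1] by simp
  show ?thesis
  proof
    assume L: "0 < c \<and> (\<lambda>x. c * x + e) ` {0..1} = {a..b}"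
    then have "{e..c + e} = {a..b}" using im[of c e] by metis
    then have "e = a" "c + e = b" using assms L by (simp_all only: Icc_eq_Icc) auto
    then have "c = b - a" by simp
    with \<open>e = a\<close> show "(\<lambda>x. c * x + e) = interval_map {a..b}" by (simp add: T)
  next
    assume R: "(\<lambda>x. c * x + e) = interval_map {a..b}"
    have "e = a" using fun_cong[OF R, of 0] by (simp add: T)
    moreover have "c = b - a" using fun_cong[OF R, of 1] \<open>e = a\<close> by (simp add: T)
    ultimately show "0 < c \<and> (\<lambda>x. c * x + e) ` {0..1} = {a..b}"
      using assms im[of c e] by simp
  qed
qed

text \<open>The generation \<open>t\<close> is an explicit argument because the same set can be a net interval of
  several generations.\<close>

definition neighbour_set ::
    "'i set \<Rightarrow> ('i \<Rightarrow> real) \<Rightarrow> ('i \<Rightarrow> real) \<Rightarrow> real set \<Rightarrow> real \<Rightarrow> real set \<Rightarrow> (real \<Rightarrow> real) set" where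
  "neighbour_set I r d K t \<Delta> =
     {inv (interval_map \<Delta>) \<circ> word_map r d \<sigma> | \<sigma>.
        \<sigma> \<in> stopping_words I r t \<and> word_map r d \<sigma> ` K \<inter> interior \<Delta> \<noteq> {}}"

definition similarity_on :: "real set \<Rightarrow> (real \<Rightarrow> real) \<Rightarrow> bool" where
  "similarity_on A g \<longleftrightarrow> (\<exists>c>0. \<forall>x\<in>A. \<forall>y\<in>A. \<bar>g x - g y\<bar> = c * \<bar>x - y\<bar>)"

end

theory Submission
  imports Defs
begin

text \<open>
  The map is \<open>g = T\<^sub>2 \<circ> T\<^sub>1\<inverse>\<close>, where \<open>T\<^sub>i\<close> is the normalising map of \<open>\<Delta>\<^sub>i\<close>. On the interior
  of \<open>\<Delta>\<^sub>i\<close> both the attractor and the measure are assembled from the neighbours: \<open>T\<^sub>i\<inverse>(K)\<close> is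
  the union of the sets \<open>f(K)\<close>, and \<open>\<mu> \<circ> T\<^sub>i\<close> is a combination, with positive weights, of the
  measures \<open>\<mu> \<circ> f\<inverse>\<close>, where \<open>f\<close> ranges over the neighbour set. Only the weights depend
  on \<open>i\<close>, and there are finitely many of them, so they are comparable. The end points
  of a net interval always lie in \<open>K\<close> and carry no mass, because \<open>\<mu>\<close> has no atoms.
\<close>

section \<open>Word maps and comparison of positive weights\<close>

lemma ifs_map_apply: "ifs_map r d i x = r i * x + d i"
  by (simp add: ifs_map_def)

lemma word_map_Nil [simp]: "word_map r d [] = id"
  by (simp add: word_map_def)

lemma word_map_Cons: "word_map r d (i # \<sigma>) = ifs_map r d i \<circ> word_map r d \<sigma>"
  by (simp add: word_map_def)

lemma word_ratio_Nil [simp]: "word_ratio r [] = 1"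
  by (simp add: word_ratio_def)

lemma word_ratio_Cons [simp]: "word_ratio r (i # \<sigma>) = r i * word_ratio r \<sigma>"
  by (simp add: word_ratio_def)

lemma continuous_on_ifs_map: "continuous_on UNIV (ifs_map r d i)"
  unfolding ifs_map_def by (intro continuous_intros)

lemma continuous_on_word_map: "continuous_on UNIV (word_map r d \<sigma>)"
proof (induction \<sigma>)
  case (Cons i \<sigma>)
  then show ?case
    unfolding word_map_Cons
    by (intro continuous_on_compose) (auto intro: continuous_on_subset[OF continuous_on_ifs_map])
qed (simp add: id_def)

lemma vimage_borel_continuous:
  fixes f :: "real \<Rightarrow> real"
  assumes "continuous_on UNIV f" "E \<in> sets borel"
  shows "f -` E \<in> sets borel"
  using measurable_sets[OF borel_measurable_continuous_onI[OF assms(1)] assms(2)] by simp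

text \<open>The largest quotient \<open>w x / v x\<close> yields the constant. It is chosen before
  \<open>m\<close>, which later makes the constants independent of the Borel set.\<close>

lemma finite_positive_weights_comparable:
  fixes v w :: "'a \<Rightarrow> real"
  assumes "finite A" "\<And>x. x \<in> A \<Longrightarrow> 0 < v x" "\<And>x. x \<in> A \<Longrightarrow> 0 < w x"
  shows "\<exists>c>0. \<forall>m. (\<forall>x\<in>A. 0 \<le> m x) \<longrightarrow> (\<Sum>x\<in>A. w x * m x) \<le> c * (\<Sum>x\<in>A. v x * m x)"
proof -
  \<comment> \<open>The inserted \<open>1\<close> keeps the maximum defined and positive when
    \<open>A\<close> is empty.\<close>
  define c where "c = Max (insert 1 ((\<lambda>x. w x / v x) ` A))"
  have "w x / v x \<le> c" if "x \<in> A" for x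
    using assms(1) that by (auto simp: c_def)
  moreover have "1 \<le> c"
    using assms(1) by (auto simp: c_def)
  ultimately have c: "0 < c" "\<And>x. x \<in> A \<Longrightarrow> w x \<le> c * v x"
    using assms(2) by (auto simp: pos_divide_le_eq)
  have "(\<Sum>x\<in>A. w x * m x) \<le> c * (\<Sum>x\<in>A. v x * m x)" if "\<forall>x\<in>A. 0 \<le> m x" for m
  proof -
    have "w x * m x \<le> c * (v x * m x)" if "x \<in> A" for x
      using mult_right_mono[OF c(2)[OF that], of "m x"] \<open>\<forall>x\<in>A. 0 \<le> m x\<close> that
      by (simp add: mult.assoc)
    then show ?thesis
      by (simp add: sum_distrib_left sum_mono)
  qed
  with c(1) show ?thesis
    by blast
qed

section \<open>Normalising maps of intervals\<close>

lemma interval_map_Icc: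
  assumes "a < b"
  shows "interval_map {a..b} x = (b - a) * x + a"
  using assms by (simp add: interval_map_def)

lemma inv_interval_map_Icc:
  assumes "a < b"
  shows "inv (interval_map {a..b}) y = (y - a) / (b - a)"
proof -
  have "inj (interval_map {a..b})"
    using assms by (auto simp: inj_def interval_map_Icc)
  moreover have "interval_map {a..b} ((y - a) / (b - a)) = y"
    using assms by (simp add: interval_map_Icc)
  ultimately show ?thesis
    by (metis inv_f_f)
qed

lemma bij_interval_map_Icc:
  assumes "a < b"
  shows "bij (interval_map {a..b})"
proof (rule bijI')
  fix y
  show "\<exists>x. y = interval_map {a..b} x"
    using assms by (intro exI[of _ "(y - a) / (b - a)"]) (simp add: interval_map_Icc)
qed (use assms in \<open>auto simp: interval_map_Icc\<close>)

lemma interval_map_vimage_image: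
  assumes "a < b"
  shows "interval_map {a..b} -` (interval_map {a..b} ` S) = S"
  by (rule inj_vimage_image_eq) (rule bij_is_inj[OF bij_interval_map_Icc[OF assms]])

lemma interval_map_image_vimage:
  assumes "a < b"
  shows "interval_map {a..b} ` (interval_map {a..b} -` S) = S"
  by (rule surj_image_vimage_eq) (rule bij_is_surj[OF bij_interval_map_Icc[OF assms]])

lemma interval_map_vimage_Ioo:
  assumes "a < b"
  shows "interval_map {a..b} -` {a<..<b} = {0<..<1}"
proof -
  have "a < interval_map {a..b} x \<longleftrightarrow> 0 < x" for x
    using assms by (simp add: interval_map_Icc zero_less_mult_iff)
  moreover have "interval_map {a..b} x < b \<longleftrightarrow> x < 1" for x
  proof -
    have "interval_map {a..b} x < b \<longleftrightarrow> (b - a) * x < (b - a) * 1"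
      unfolding interval_map_Icc[OF assms] by (simp only: mult_1_right less_diff_eq)
    then show ?thesis
      using assms by (simp only: mult_less_cancel_left_pos diff_gt_0_iff_gt)
  qed
  ultimately show ?thesis
    by auto
qed

lemma interval_map_vimage_borel:
  assumes "a < b" "S \<in> sets borel"
  shows "interval_map {a..b} -` S \<in> sets borel"
proof (rule vimage_borel_continuous[OF _ assms(2)])
  show "continuous_on UNIV (interval_map {a..b})"
    unfolding interval_map_def by (intro continuous_intros)
qed

text \<open>Continuous images of Borel sets need not be Borel in general; here the image is a
  preimage under the inverse map, which is continuous.\<close>

lemma interval_map_image_borel:
  assumes "a < b" "S \<in> sets borel"
  shows "interval_map {a..b} ` S \<in> sets borel"
proof -
  have "interval_map {a..b} ` S = inv (interval_map {a..b}) -` S"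
    using bij_image_Collect_eq[OF bij_interval_map_Icc[OF assms(1)], of "\<lambda>x. x \<in> S"]
    by (simp add: vimage_def)
  moreover have "continuous_on UNIV (inv (interval_map {a..b}))"
    using assms(1) by (subst inv_interval_map_Icc[OF assms(1), abs_def]) (intro continuous_intros, auto)
  ultimately show ?thesis
    using vimage_borel_continuous[OF _ assms(2)] by metis
qed

section \<open>Stopping words and induction on the scale\<close>

locale ifs =
  fixes I :: "'i set" and r d :: "'i \<Rightarrow> real"
  assumes is_ifs: "is_ifs I r"
begin

lemma finite_I: "finite I" and I_nonempty: "I \<noteq> {}"
  using is_ifs by (auto simp: is_ifs_def)

lemma ratio_pos: "i \<in> I \<Longrightarrow> 0 < \<bar>r i\<bar>" and ratio_less_1: "i \<in> I \<Longrightarrow> \<bar>r i\<bar> < 1"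
  using is_ifs by (auto simp: is_ifs_def)

lemma ratio_nonzero: "i \<in> I \<Longrightarrow> r i \<noteq> 0"
  using ratio_pos by force

text \<open>Finiteness of \<open>I\<close> yields a single contraction factor for all maps, the
  source of geometric decay below.\<close>

lemma uniform_ratio: "\<exists>\<rho>. 0 < \<rho> \<and> \<rho> < 1 \<and> (\<forall>i\<in>I. \<bar>r i\<bar> \<le> \<rho>)"
proof -
  let ?\<rho> = "Max ((\<lambda>i. \<bar>r i\<bar>) ` I)"
  have fin: "finite ((\<lambda>i. \<bar>r i\<bar>) ` I)" "(\<lambda>i. \<bar>r i\<bar>) ` I \<noteq> {}"
    using finite_I I_nonempty by auto
  then have "?\<rho> \<in> (\<lambda>i. \<bar>r i\<bar>) ` I"
    by (rule Max_in)
  then have "0 < ?\<rho>" "?\<rho> < 1"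
    using ratio_pos ratio_less_1 by (metis imageE)+
  moreover have "\<bar>r i\<bar> \<le> ?\<rho>" if "i \<in> I" for i
    using fin(1) that by (intro Max_ge) auto
  ultimately show ?thesis
    by blast
qed

lemma word_ratio_le_1: "\<sigma> \<in> lists I \<Longrightarrow> \<bar>word_ratio r \<sigma>\<bar> \<le> 1"
proof (induction \<sigma>)
  case (Cons i \<sigma>)
  then show ?case
    using mult_mono[of "\<bar>r i\<bar>" 1 "\<bar>word_ratio r \<sigma>\<bar>" 1] ratio_less_1[of i]
    by (auto simp: abs_mult)
qed simp

lemma stopping_words_gt_1:
  assumes "1 < t"
  shows "stopping_words I r t = {[]}"
proof -
  have "\<not> t \<le> \<bar>word_ratio r (butlast \<sigma>)\<bar>" if "\<sigma> \<in> lists I" for \<sigma>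
  proof -
    have "butlast \<sigma> \<in> lists I"
      using that by (auto dest: in_set_butlastD)
    then show ?thesis
      using word_ratio_le_1[of "butlast \<sigma>"] assms by simp
  qed
  then show ?thesis
    using assms by (auto simp: stopping_words_def)
qed

text \<open>Removing the first letter \<open>i\<close> divides the ratio of a word by
  \<open>r i\<close>. The bound \<open>t \<le> 1\<close> excludes the empty word and supplies the
  lower inequality for one-letter words, whose parent has ratio \<open>1\<close>.\<close>

lemma stopping_words_le_1:
  assumes "t \<le> 1"
  shows "stopping_words I r t = (\<Union>i\<in>I. (#) i ` stopping_words I r (t / \<bar>r i\<bar>))"
proof -
  have "i # \<sigma> \<in> stopping_words I r t \<longleftrightarrow> i \<in> I \<and> \<sigma> \<in> stopping_words I r (t / \<bar>r i\<bar>)" for i \<sigma>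
  proof (cases "i \<in> I")
    case True
    then show ?thesis
      using ratio_pos[OF True] assms
      by (auto simp: stopping_words_def abs_mult pos_less_divide_eq pos_divide_le_eq mult.commute)
  qed (simp add: stopping_words_def)
  moreover have "[] \<notin> stopping_words I r t"
    using assms by (simp add: stopping_words_def)
  ultimately have "\<sigma> \<in> stopping_words I r t \<longleftrightarrow>
      \<sigma> \<in> (\<Union>i\<in>I. (#) i ` stopping_words I r (t / \<bar>r i\<bar>))" for \<sigma>
    by (cases \<sigma>) auto
  then show ?thesis
    by blast
qed

text \<open>The recursion of \<open>stopping_words_le_1\<close> divides \<open>t\<close> by a ratio below \<open>1\<close>, so it reaches
  a scale above \<open>1\<close> after finitely many steps.\<close>

lemma scale_induct [consumes 1, case_names large small]:
  assumes "0 < t"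
    and large: "\<And>t. 1 < t \<Longrightarrow> P t"
    and small: "\<And>t. 0 < t \<Longrightarrow> t \<le> 1 \<Longrightarrow> (\<And>i. i \<in> I \<Longrightarrow> P (t / \<bar>r i\<bar>)) \<Longrightarrow> P t"
  shows "P t"
proof -
  obtain \<rho> where \<rho>: "0 < \<rho>" "\<rho> < 1" "\<And>i. i \<in> I \<Longrightarrow> \<bar>r i\<bar> \<le> \<rho>"
    using uniform_ratio by blast
  \<comment> \<open>Here \<open>n\<close> bounds the depth of the recursion: dividing
    \<open>t\<close> by a ratio of at most \<open>\<rho>\<close> turns the bound
    \<open>\<rho> ^ Suc n\<close> into \<open>\<rho> ^ n\<close>, and \<open>n = 0\<close> is the
    large case.\<close>
  have "P t" if "\<rho> ^ n < t" for n t
    using that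
  proof (induction n arbitrary: t)
    case 0
    then show ?case
      using large by simp
  next
    case (Suc n)
    show ?case
    proof (cases "1 < t")
      case False
      have "0 < t"
        using Suc.prems \<rho>(1) zero_less_power[of \<rho> "Suc n"] by linarith
      moreover have "P (t / \<bar>r i\<bar>)" if "i \<in> I" for i
      proof (rule Suc.IH)
        have "\<rho> ^ n * \<bar>r i\<bar> \<le> \<rho> ^ n * \<rho>"
          using \<rho> that by (intro mult_left_mono) auto
        also have "\<dots> < t"
          using Suc.prems by (simp add: mult.commute)
        finally show "\<rho> ^ n < t / \<bar>r i\<bar>"
          using ratio_pos[OF that] by (simp add: pos_less_divide_eq)
      qed
      ultimately show ?thesis
        using False by (intro small[of t]) auto
    qed (rule large)
  qed
  moreover obtain n where "\<rho> ^ n < t"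
    using real_arch_pow_inv[OF \<open>0 < t\<close> \<rho>(2)] by blast
  ultimately show ?thesis
    by blast
qed

lemma finite_stopping_words: "0 < t \<Longrightarrow> finite (stopping_words I r t)"
  by (induction t rule: scale_induct)
    (simp_all add: stopping_words_gt_1 stopping_words_le_1 finite_I)

text \<open>Words with different first letters differ, so the union in
  \<open>stopping_words_le_1\<close> is disjoint; prepending a fixed letter is injective.\<close>

lemma sum_stopping_words_le_1:
  assumes "0 < t" "t \<le> 1"
  shows "(\<Sum>\<sigma>\<in>stopping_words I r t. h \<sigma>) =
    (\<Sum>i\<in>I. \<Sum>\<sigma>\<in>stopping_words I r (t / \<bar>r i\<bar>). h (i # \<sigma>))"
proof -
  have "(\<Sum>\<sigma>\<in>stopping_words I r t. h \<sigma>) =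
      (\<Sum>i\<in>I. \<Sum>\<sigma>\<in>(#) i ` stopping_words I r (t / \<bar>r i\<bar>). h \<sigma>)"
    unfolding stopping_words_le_1[OF assms(2)]
    by (intro sum.UNION_disjoint finite_I ballI finite_imageI finite_stopping_words)
      (use assms(1) ratio_pos in auto)
  then show ?thesis
    by (simp add: sum.reindex)
qed

end

section \<open>The attractor and its cylinders\<close>

locale attractor = ifs I r d for I :: "'i set" and r d :: "'i \<Rightarrow> real" +
  fixes K :: "real set"
  assumes is_attractor: "is_attractor I r d K"
begin

lemma compact_K: "compact K" and K_nonempty: "K \<noteq> {}"
  and K_eq: "K = (\<Union>i\<in>I. ifs_map r d i ` K)"
  using is_attractor by (auto simp: is_attractor_def)

text \<open>Each first-level copy of \<open>K\<close> is subdivided by the induction hypothesis at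
  scale \<open>t / \<bar>r i\<bar>\<close>; above scale \<open>1\<close> only the empty word
  remains.\<close>

lemma K_eq_stopping: "0 < t \<Longrightarrow> K = (\<Union>\<sigma>\<in>stopping_words I r t. word_map r d \<sigma> ` K)"
proof (induction t rule: scale_induct)
  case (large t)
  then show ?case
    by (simp add: stopping_words_gt_1)
next
  case (small t)
  have "K = (\<Union>i\<in>I. ifs_map r d i ` K)"
    by (rule K_eq)
  also have "\<dots> = (\<Union>i\<in>I. ifs_map r d i ` (\<Union>\<sigma>\<in>stopping_words I r (t / \<bar>r i\<bar>). word_map r d \<sigma> ` K))"
    by (intro SUP_cong refl arg_cong2[where f = image] small.IH)
  also have "\<dots> = (\<Union>\<sigma>\<in>stopping_words I r t. word_map r d \<sigma> ` K)"
    using small.hyps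
    by (auto simp: stopping_words_le_1 word_map_Cons)
  finally show ?case .
qed

lemma word_map_in_K:
  assumes "0 < t" "\<sigma> \<in> stopping_words I r t" "y \<in> K"
  shows "word_map r d \<sigma> y \<in> K"
  by (subst K_eq_stopping[OF assms(1)]) (use assms in blast)

lemma in_K_stoppingE:
  assumes "x \<in> K" "0 < t"
  obtains \<sigma> y where "\<sigma> \<in> stopping_words I r t" "y \<in> K" "x = word_map r d \<sigma> y"
proof -
  have "x \<in> (\<Union>\<sigma>\<in>stopping_words I r t. word_map r d \<sigma> ` K)"
    using assms(1) by (subst (asm) K_eq_stopping[OF assms(2)])
  then show thesis
    using that by blast
qed

text \<open>A point of \<open>K\<close> farthest from \<open>x\<close> is the image of some point of
  \<open>K\<close> under a contraction fixing \<open>x\<close>, so the farthest distance is zero.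
  This gives the contradiction in \<open>no_atoms\<close>.\<close>

lemma common_fixed_point_singleton:
  assumes "\<And>i. i \<in> I \<Longrightarrow> ifs_map r d i x = x"
  shows "K = {x}"
proof -
  obtain y where y: "y \<in> K" "\<And>z. z \<in> K \<Longrightarrow> dist x z \<le> dist x y"
    using distance_attains_sup[OF compact_K K_nonempty] by blast
  obtain i z where iz: "i \<in> I" "z \<in> K" "y = ifs_map r d i z"
    using y(1) K_eq by blast
  have "dist x y = \<bar>r i\<bar> * dist x z"
    using assms[OF iz(1)] iz(3)
    by (metis (no_types, opaque_lifting) abs_mult add_diff_cancel_right dist_real_def ifs_map_apply right_diff_distrib)
  also have "\<dots> \<le> \<bar>r i\<bar> * dist x y"
    using y(2)[OF iz(2)] by (intro mult_left_mono) auto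
  finally have "(1 - \<bar>r i\<bar>) * dist x y \<le> 0"
    by (simp add: algebra_simps)
  then have "dist x y = 0"
    using ratio_less_1[OF iz(1)] by (metis diff_gt_0_iff_gt linorder_not_le mult_pos_pos zero_le_dist less_le)
  then have "K \<subseteq> {x}"
    using y(2) by auto
  then show ?thesis
    using K_nonempty by blast
qed

text \<open>A point of \<open>K\<close> nearest to \<open>x\<close> is mapped to a point of
  \<open>K\<close>, with the distance scaled by \<open>\<bar>r i\<bar>\<close>.\<close>

lemma infdist_ifs_map:
  assumes "i \<in> I"
  shows "infdist (ifs_map r d i x) K \<le> \<bar>r i\<bar> * infdist x K"
proof -
  obtain y where y: "y \<in> K" "infdist x K = dist x y"
    using infdist_attains_inf[OF compact_imp_closed[OF compact_K] K_nonempty] by metis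
  have "ifs_map r d i y \<in> K"
    using K_eq assms y(1) by blast
  then have "infdist (ifs_map r d i x) K \<le> dist (ifs_map r d i x) (ifs_map r d i y)"
    by (rule infdist_le)
  also have "\<dots> = \<bar>r i\<bar> * dist x y"
    by (simp add: ifs_map_apply dist_real_def abs_mult[symmetric] right_diff_distrib)
  finally show ?thesis
    by (simp add: y)
qed

end

section \<open>The self-similar measure: decomposition over words, support, absence of atoms\<close>

locale self_similar = attractor I r d K
  for I :: "'i set" and r d :: "'i \<Rightarrow> real" and K +
  fixes p :: "'i \<Rightarrow> real" and \<mu> :: "real measure"
  assumes not_singleton: "\<nexists>x. K = {x}"
    and hull_K: "convex hull K = {0..1}"
    and prob_vector: "is_prob_vector I p"
    and self_similar: "is_self_similar_measure I r d p \<mu>"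
begin

sublocale prob_space \<mu>
  using self_similar by (simp add: is_self_similar_measure_def)

lemma sets_\<mu> [simp]: "sets \<mu> = sets borel"
  using self_similar by (simp add: is_self_similar_measure_def)

lemma p_pos: "i \<in> I \<Longrightarrow> 0 < p i" and sum_p: "(\<Sum>i\<in>I. p i) = 1"
  using prob_vector by (auto simp: is_prob_vector_def)

lemma measure_self_similar:
  "E \<in> sets borel \<Longrightarrow> prob E = (\<Sum>i\<in>I. p i * prob (ifs_map r d i -` E))"
  using self_similar by (simp add: is_self_similar_measure_def)

text \<open>Applied to \<open>p\<close> in place of \<open>r\<close>, \<open>word_ratio\<close> is
  the product of the probabilities along a word, its weight in the iterated self-similarity
  relation.\<close>

lemma word_weight_pos: "\<sigma> \<in> lists I \<Longrightarrow> 0 < word_ratio p \<sigma>"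
  by (induction \<sigma>) (auto simp: p_pos)

text \<open>The self-similarity relation is iterated by scale induction. \<open>E\<close> stays
  arbitrary because the induction hypothesis is applied to its preimages under the maps.\<close>

lemma measure_stopping:
  assumes "0 < t" "E \<in> sets borel"
  shows "prob E = (\<Sum>\<sigma>\<in>stopping_words I r t. word_ratio p \<sigma> * prob (word_map r d \<sigma> -` E))"
  using assms
proof (induction t arbitrary: E rule: scale_induct)
  case (large t)
  then show ?case
    by (simp add: stopping_words_gt_1)
next
  case (small t)
  have "prob E = (\<Sum>i\<in>I. p i * prob (ifs_map r d i -` E))"
    by (rule measure_self_similar) fact
  also have "\<dots> = (\<Sum>i\<in>I. p i * (\<Sum>\<sigma>\<in>stopping_words I r (t / \<bar>r i\<bar>).
      word_ratio p \<sigma> * prob (word_map r d \<sigma> -` (ifs_map r d i -` E))))"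
    by (intro sum.cong refl arg_cong2[where f = times] small.IH
        vimage_borel_continuous[OF continuous_on_ifs_map] small.prems)
  also have "\<dots> = (\<Sum>\<sigma>\<in>stopping_words I r t. word_ratio p \<sigma> * prob (word_map r d \<sigma> -` E))"
    using small.hyps
    by (simp add: sum_stopping_words_le_1 word_map_Cons sum_distrib_left mult.assoc vimage_comp)
  finally show ?case .
qed

text \<open>The mass beyond distance \<open>s\<close> from \<open>K\<close> is at most the mass beyond distance \<open>s / \<rho>\<close>, as
  every map contracts the distance to \<open>K\<close> by \<open>\<rho>\<close>.\<close>

lemma prob_far_from_K:
  assumes "0 < s"
  shows "prob {x. s < infdist x K} = 0"
proof -
  obtain \<rho> where \<rho>: "0 < \<rho>" "\<rho> < 1" "\<And>i. i \<in> I \<Longrightarrow> \<bar>r i\<bar> \<le> \<rho>"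
    using uniform_ratio by blast
  have meas: "{x. u < infdist x K} \<in> sets borel" for u
    by (intro borel_open open_Collect_less continuous_intros)
  have step: "prob {x. u * \<rho> < infdist x K} \<le> prob {x. u < infdist x K}" for u
  proof -
    have "prob (ifs_map r d i -` {x. u * \<rho> < infdist x K}) \<le> prob {x. u < infdist x K}"
      if "i \<in> I" for i
    proof (rule finite_measure_mono)
      have "u < infdist x K" if "u * \<rho> < infdist (ifs_map r d i x) K" for x
      proof -
        have "u * \<rho> < \<bar>r i\<bar> * infdist x K"
          using that infdist_ifs_map[OF \<open>i \<in> I\<close>, of x] by linarith
        also have "\<dots> \<le> infdist x K * \<rho>"
          using \<rho>(3)[OF \<open>i \<in> I\<close>] infdist_nonneg[of x K] by (subst mult.commute) (intro mult_left_mono)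
        finally show ?thesis
          using \<rho>(1) by simp
      qed
      then show "ifs_map r d i -` {x. u * \<rho> < infdist x K} \<subseteq> {x. u < infdist x K}"
        by auto
    qed (simp add: meas)
    then have "prob {x. u * \<rho> < infdist x K} \<le> (\<Sum>i\<in>I. p i * prob {x. u < infdist x K})"
      unfolding measure_self_similar[OF meas] using p_pos
      by (intro sum_mono mult_left_mono) (auto intro: less_imp_le)
    then show ?thesis
      by (simp add: sum_distrib_right[symmetric] sum_p)
  qed
  \<comment> \<open>Iterating \<open>step\<close> raises the distance to
    \<open>s / \<rho> ^ n\<close>, which tends to infinity. The sets \<open>U n\<close> decrease to
    the empty set, so by continuity from above their masses tend to zero.\<close>
  define U where "U n = {x. s / \<rho> ^ n < infdist x K}" for n
  have le: "prob {x. s < infdist x K} \<le> prob (U n)" for n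
  proof (induction n)
    case (Suc n)
    have "s / \<rho> ^ n = s / \<rho> ^ Suc n * \<rho>"
      using \<rho>(1) by simp
    then have "prob (U n) \<le> prob (U (Suc n))"
      using step[of "s / \<rho> ^ Suc n"] by (simp only: U_def)
    with Suc show ?case
      by linarith
  qed (simp add: U_def)
  have "decseq U"
    unfolding U_def
  proof (intro decseq_SucI Collect_mono impI)
    fix n x
    assume "s / \<rho> ^ Suc n < infdist x K"
    moreover have "s / \<rho> ^ n \<le> s / \<rho> ^ Suc n"
      using \<rho> assms by (intro divide_left_mono power_decreasing) auto
    ultimately show "s / \<rho> ^ n < infdist x K"
      by linarith
  qed
  then have "(\<lambda>n. prob (U n)) \<longlonglongrightarrow> prob (\<Inter>n. U n)"
    using meas by (intro finite_Lim_measure_decseq) (auto simp: U_def[abs_def])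
  moreover have "(\<Inter>n. U n) = {}"
  proof -
    have "\<exists>n. x \<notin> U n" for x
    proof -
      \<comment> \<open>Adding \<open>1\<close> keeps the denominator positive at points of
        \<open>K\<close>.\<close>
      have "0 < s / (infdist x K + 1)"
        using assms infdist_nonneg[of x K] by simp
      then obtain n where "\<rho> ^ n < s / (infdist x K + 1)"
        using real_arch_pow_inv \<rho>(2) by blast
      then have "infdist x K + 1 < s / \<rho> ^ n"
        using \<rho>(1) infdist_nonneg[of x K]
        by (simp add: pos_less_divide_eq mult.commute)
      then show ?thesis
        by (intro exI[of _ n]) (simp add: U_def)
    qed
    then show ?thesis
      by blast
  qed
  ultimately have "prob {x. s < infdist x K} \<le> 0"
    using le by (intro LIMSEQ_le_const) auto
  then show ?thesis
    using measure_nonneg by (intro antisym) auto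
qed

text \<open>As \<open>K\<close> is closed, points outside it have positive distance from it; the
  complement is thus a countable union of null sets from \<open>prob_far_from_K\<close>.\<close>

lemma null_outside_K: "- K \<in> null_sets \<mu>"
proof -
  have "- K = (\<Union>n::nat. {x. 1 / real (Suc n) < infdist x K})"
  proof (intro subset_antisym subsetI)
    fix x
    assume "x \<in> - K"
    then have "0 < infdist x K"
      using infdist_pos_not_in_closed compact_imp_closed[OF compact_K] K_nonempty by blast
    then show "x \<in> (\<Union>n::nat. {x. 1 / real (Suc n) < infdist x K})"
      using nat_approx_posE by (metis (mono_tags) UN_I UNIV_I mem_Collect_eq)
  next
    fix x
    assume "x \<in> (\<Union>n::nat. {x. 1 / real (Suc n) < infdist x K})"
    then obtain n :: nat where "1 / real (Suc n) < infdist x K"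
      by blast
    then have "infdist x K \<noteq> 0"
      by (metis of_nat_0_le_iff zero_le_divide_1_iff linorder_not_less)
    then show "x \<in> - K"
      by auto
  qed
  moreover have "{x. 1 / real (Suc n) < infdist x K} \<in> null_sets \<mu>" for n
  proof (rule null_setsI)
    show "emeasure \<mu> {x. 1 / real (Suc n) < infdist x K} = 0"
      by (simp add: emeasure_eq_measure prob_far_from_K del: of_nat_Suc)
    show "{x. 1 / real (Suc n) < infdist x K} \<in> sets \<mu>"
      unfolding sets_\<mu> by (intro borel_open open_Collect_less continuous_intros)
  qed
  then have "(\<Union>n::nat. {x. 1 / real (Suc n) < infdist x K}) \<in> null_sets \<mu>"
    by (rule null_sets_UN)
  ultimately show ?thesis
    by (simp only:)
qed

text \<open>More than \<open>1 / e\<close> such points would carry mass greater than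
  \<open>1\<close>.\<close>

lemma finite_large_atoms:
  assumes "0 < e"
  shows "finite {x. e \<le> prob {x}}"
proof (rule ccontr)
  assume inf: "infinite {x. e \<le> prob {x}}"
  obtain n :: nat where n: "1 < real n * e"
    using reals_Archimedean3[OF assms] by blast
  obtain F where F: "finite F" "card F = n" "F \<subseteq> {x. e \<le> prob {x}}"
    using infinite_arbitrarily_large[OF inf] by blast
  have "real n * e \<le> (\<Sum>x\<in>F. prob {x})"
    using F sum_bounded_below[of F e "\<lambda>x. prob {x}"] by auto
  also have "\<dots> = prob F"
    using F(1) by (intro finite_measure_eq_sum_singleton[symmetric]) auto
  also have "\<dots> \<le> 1"
    by (rule prob_le_1)
  finally show False
    using n by simp
qed

text \<open>The finite set of heaviest atoms is mapped into itself by every expansion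
  \<open>S\<^sub>i\<inverse>\<close>. Hence it is a single point, which all the \<open>S\<^sub>i\<close> fix.\<close>

lemma no_atoms: "prob {x} = 0"
proof (rule ccontr)
  assume "prob {x} \<noteq> 0"
  then have pos: "0 < prob {x}"
    using measure_nonneg[of \<mu> "{x}"] by linarith
  \<comment> \<open>This set is finite and contains \<open>x\<close>, so a largest mass
    \<open>m\<close> is attained on it. Points outside are lighter than \<open>x\<close>, so
    \<open>m\<close> is the largest mass of any point.\<close>
  define C where "C = {y. prob {x} \<le> prob {y}}"
  define m where "m = Max ((\<lambda>y. prob {y}) ` C)"
  define A where "A = {y. prob {y} = m}"
  have C: "finite C" "x \<in> C"
    using finite_large_atoms[OF pos] by (auto simp: C_def)
  then have m_ge: "prob {x} \<le> m" and m_C: "\<And>y. y \<in> C \<Longrightarrow> prob {y} \<le> m"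
    unfolding m_def by auto
  have max: "prob {y} \<le> m" for y
    using m_ge m_C[of y] by (cases "y \<in> C") (auto simp: C_def)
  have "m \<in> (\<lambda>y. prob {y}) ` C"
    unfolding m_def using C by (intro Max_in) auto
  then have A: "A \<noteq> {}" "finite A"
    using C m_ge by (auto simp: A_def C_def intro: finite_subset[OF _ C(1)[unfolded C_def]])
  have vim: "ifs_map r d i -` {y} = {(y - d i) / r i}" if "i \<in> I" for i y
    using ratio_nonzero[OF that] by (auto simp: ifs_map_apply field_simps)
  \<comment> \<open>The mass \<open>m\<close> of \<open>y\<close> is a weighted average of the
    masses of its preimages. None of these exceeds \<open>m\<close> and all weights are positive, so
    each equals \<open>m\<close>.\<close>
  have inv: "(y - d i) / r i \<in> A" if y: "y \<in> A" and i: "i \<in> I" for y i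
  proof -
    have "prob {y} = (\<Sum>i\<in>I. p i * prob {(y - d i) / r i})"
      using measure_self_similar[of "{y}"] by (simp add: vim)
    then have "(\<Sum>i\<in>I. p i * (m - prob {(y - d i) / r i})) = 0"
      using y by (simp add: A_def right_diff_distrib sum_subtractf sum_distrib_right[symmetric] sum_p)
    moreover have "\<And>i. i \<in> I \<Longrightarrow> 0 \<le> p i * (m - prob {(y - d i) / r i})"
      using p_pos max by (simp add: less_imp_le)
    ultimately have "p i * (m - prob {(y - d i) / r i}) = 0"
      using sum_nonneg_0[OF finite_I, of "\<lambda>i. p i * (m - prob {(y - d i) / r i})" i] i by simp
    then show ?thesis
      using p_pos[OF i] by (auto simp: A_def)
  qed
  \<comment> \<open>An expansion carries a pair of \<open>A\<close> at maximal distance to a pair of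
    \<open>A\<close> that is farther apart, unless that distance is zero.\<close>
  have "compact A"
    using A(2) by (rule finite_imp_compact)
  then obtain y z where "y \<in> A" "z \<in> A" "dist y z = diameter A"
    using diameter_compact_attained A(1) by blast
  then have yz: "y \<in> A" "z \<in> A" "\<And>y' z'. y' \<in> A \<Longrightarrow> z' \<in> A \<Longrightarrow> dist y' z' \<le> dist y z"
    using diameter_bounded_bound[OF compact_imp_bounded[OF \<open>compact A\<close>]] by auto
  obtain j where j: "j \<in> I"
    using I_nonempty by blast
  have "dist ((y - d j) / r j) ((z - d j) / r j) = dist y z / \<bar>r j\<bar>"
    by (simp add: dist_real_def diff_divide_distrib[symmetric])
  then have "dist y z / \<bar>r j\<bar> \<le> dist y z"
    using yz(3)[OF inv[OF yz(1) j] inv[OF yz(2) j]] by simp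
  then have "dist y z * (1 - \<bar>r j\<bar>) \<le> 0"
    using ratio_pos[OF j] by (simp add: field_simps)
  then have "dist y z = 0"
    using ratio_less_1[OF j] by (metis diff_gt_0_iff_gt linorder_not_le mult_pos_pos zero_le_dist less_le)
  then have single: "y' = y" if "y' \<in> A" for y'
    using yz(3)[OF that yz(1)] by simp
  have "ifs_map r d i y = y" if "i \<in> I" for i
    using single[OF inv[OF yz(1) that]] ratio_nonzero[OF that]
    by (simp add: ifs_map_apply field_simps)
  then show False
    using common_fixed_point_singleton not_singleton by blast
qed

text \<open>Finite sets are null by \<open>no_atoms\<close>; this disposes of the end points of net
  intervals.\<close>

lemma prob_eq_up_to_null:
  assumes "E \<in> sets borel" "F \<in> sets borel" "finite X" "E \<subseteq> F \<union> X" "F \<subseteq> E \<union> X"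
  shows "prob E = prob F"
proof -
  have X: "X \<in> null_sets \<mu>"
  proof (rule null_setsI)
    have "prob X = (\<Sum>x\<in>X. prob {x})"
      using assms(3) by (intro finite_measure_eq_sum_singleton) auto
    then show "emeasure \<mu> X = 0"
      by (simp add: emeasure_eq_measure no_atoms)
    show "X \<in> sets \<mu>"
      using assms(3) by (simp add: borel_closed finite_imp_closed)
  qed
  have "prob E = prob (E \<union> X)" "prob F = prob (F \<union> X)"
    using X assms(1,2) by (simp_all add: measure_Un_null_set)
  moreover have "E \<union> X = F \<union> X"
    using assms(4,5) by blast
  ultimately show ?thesis
    by simp
qed

section \<open>Net intervals and their neighbour sets\<close>

lemma endpoints_in_K: "0 \<in> K" "1 \<in> K"
proof -
  \<comment> \<open>Extreme points of a convex hull belong to the generating set.\<close>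
  have "0 extreme_point_of convex hull K" "1 extreme_point_of convex hull K"
    unfolding hull_K extreme_point_of_def
    by (auto simp: open_segment_eq_real_ivl split: if_splits)
  then show "0 \<in> K" "1 \<in> K"
    by (simp_all add: extreme_point_of_convex_hull)
qed

text \<open>Neighbour sets only see the interior of a net interval. That its end points always lie
  in \<open>K\<close> settles the boundary independently of them.\<close>

lemma net_points_subset_K:
  assumes "0 < t"
  shows "net_points I r d t \<subseteq> K"
  unfolding net_points_def
  by (intro UN_least insert_subsetI empty_subsetI word_map_in_K[OF assms] endpoints_in_K)

lemma net_intervalE:
  assumes "\<Delta> \<in> net_intervals I r d K t" "0 < t"
  obtains a b where "\<Delta> = {a..b}" "a < b" "a \<in> K" "b \<in> K"
proof -
  obtain a b where "\<Delta> = {a..b}" "a \<in> net_points I r d t" "b \<in> net_points I r d t" "a < b"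
    using assms(1) unfolding net_intervals_def by (elim CollectE exE conjE)
  then show thesis
    using net_points_subset_K[OF assms(2)] that by blast
qed

lemma finite_neighbour_set:
  assumes "0 < t"
  shows "finite (neighbour_set I r d K t \<Delta>)"
proof -
  have "neighbour_set I r d K t \<Delta> \<subseteq>
      (\<lambda>\<sigma>. inv (interval_map \<Delta>) \<circ> word_map r d \<sigma>) ` stopping_words I r t"
    by (auto simp: neighbour_set_def)
  then show ?thesis
    using finite_stopping_words[OF assms] finite_surj by blast
qed

text \<open>Every cylinder meeting the open interval is recorded by a neighbour, so the neighbour
  set alone determines the normalised attractor there. A cylinder meeting the interval only at an
  end point is not recorded, hence the restriction to \<open>{0<..<1}\<close>.\<close>

lemma neighbour_set_K:
  assumes "0 < t" "a < b"
  shows "interval_map {a..b} -` K \<inter> {0<..<1} =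
    (\<Union>f\<in>neighbour_set I r d K t {a..b}. f ` K) \<inter> {0<..<1}" (is "?L = ?R")
proof -
  let ?T = "interval_map {a..b}"
  have Tinv: "?T (inv ?T y) = y" "inv ?T (?T x) = x" for x y
    using bij_interval_map_Icc[OF assms(2)] by (simp_all add: bij_is_inj bij_is_surj surj_f_inv_f)
  have int: "?T x \<in> {a<..<b} \<longleftrightarrow> x \<in> {0<..<1}" for x
    using interval_map_vimage_Ioo[OF assms(2)] by blast
  show ?thesis
  proof (intro subset_antisym subsetI)
    fix x
    assume x: "x \<in> ?L"
    then have "?T x \<in> K"
      by simp
    then obtain \<sigma> y where \<sigma>: "\<sigma> \<in> stopping_words I r t" "y \<in> K" "?T x = word_map r d \<sigma> y"
      using assms(1) by (rule in_K_stoppingE)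
    then have "word_map r d \<sigma> ` K \<inter> interior {a..b} \<noteq> {}"
      using x int[of x] by (auto simp: interior_atLeastAtMost_real)
    then have "inv ?T \<circ> word_map r d \<sigma> \<in> neighbour_set I r d K t {a..b}"
      using \<sigma>(1) by (auto simp: neighbour_set_def)
    moreover have "x = (inv ?T \<circ> word_map r d \<sigma>) y"
      using \<sigma>(3) Tinv(2)[of x] by simp
    ultimately show "x \<in> ?R"
      using x \<sigma>(2) by blast
  next
    fix x
    assume x: "x \<in> ?R"
    then obtain f y where f: "f \<in> neighbour_set I r d K t {a..b}" "y \<in> K" "x = f y"
      by blast
    then obtain \<sigma> where \<sigma>: "\<sigma> \<in> stopping_words I r t" "f = inv ?T \<circ> word_map r d \<sigma>"
      unfolding neighbour_set_def by blast
    with f have "?T x \<in> K"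
      by (simp add: Tinv word_map_in_K[OF assms(1)])
    then show "x \<in> ?L"
      using x by simp
  qed
qed

text \<open>In \<open>measure_stopping\<close>, a word giving no neighbour contributes nothing: it
  maps \<open>K\<close>, which carries all the mass, off the open interval. The weights are fixed
  before \<open>E\<close>.\<close>

lemma neighbour_set_measure:
  assumes "0 < t" "a < b"
  shows "\<exists>w. (\<forall>f\<in>neighbour_set I r d K t {a..b}. 0 < w f) \<and>
    (\<forall>E\<in>sets borel. E \<subseteq> {a<..<b} \<longrightarrow>
      prob E = (\<Sum>f\<in>neighbour_set I r d K t {a..b}. w f * prob (f -` (interval_map {a..b} -` E))))"
proof -
  let ?T = "interval_map {a..b}"
  define N where "N = {\<sigma> \<in> stopping_words I r t. word_map r d \<sigma> ` K \<inter> interior {a..b} \<noteq> {}}"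
  define nb where "nb \<sigma> = inv ?T \<circ> word_map r d \<sigma>" for \<sigma>
  \<comment> \<open>Different words may give the same neighbour, whose weight therefore collects the
    weights of all of them.\<close>
  define w where "w f = (\<Sum>\<sigma> | \<sigma> \<in> N \<and> nb \<sigma> = f. word_ratio p \<sigma>)" for f
  have V: "neighbour_set I r d K t {a..b} = nb ` N"
    by (auto simp: neighbour_set_def N_def nb_def)
  have finN: "finite N"
    using finite_stopping_words[OF assms(1)] by (simp add: N_def)
  have lists: "\<sigma> \<in> lists I" if "\<sigma> \<in> N" for \<sigma>
    using that by (auto simp: N_def stopping_words_def)
  show ?thesis
  proof (intro exI[of _ w] conjI ballI impI)
    fix f
    assume "f \<in> neighbour_set I r d K t {a..b}"
    then show "0 < w f"
      unfolding w_def using finN lists by (intro sum_pos) (auto simp: V word_weight_pos)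
  next
    fix E :: "real set"
    assume E: "E \<in> sets borel" "E \<subseteq> {a<..<b}"
    have zero: "prob (word_map r d \<sigma> -` E) = 0" if "\<sigma> \<in> stopping_words I r t - N" for \<sigma>
    proof -
      have "word_map r d \<sigma> -` E \<subseteq> - K"
        using that E(2) by (auto simp: N_def interior_atLeastAtMost_real)
      then have "word_map r d \<sigma> -` E \<in> null_sets \<mu>"
        using vimage_borel_continuous[OF continuous_on_word_map E(1)]
        by (intro null_sets_subset[OF null_outside_K]) auto
      then show ?thesis
        by (simp add: measure_eq_0_null_sets)
    qed
    have vim: "nb \<sigma> -` (?T -` E) = word_map r d \<sigma> -` E" for \<sigma>
      using bij_interval_map_Icc[OF assms(2)]
      by (auto simp: nb_def bij_is_surj surj_f_inv_f)
    have "prob E = (\<Sum>\<sigma>\<in>stopping_words I r t. word_ratio p \<sigma> * prob (word_map r d \<sigma> -` E))"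
      by (rule measure_stopping) fact+
    also have "\<dots> = (\<Sum>\<sigma>\<in>N. word_ratio p \<sigma> * prob (word_map r d \<sigma> -` E))"
      using finite_stopping_words[OF assms(1)] zero
      by (intro sum.mono_neutral_right) (auto simp: N_def)
    also have "\<dots> = (\<Sum>\<sigma>\<in>N. word_ratio p \<sigma> * prob (nb \<sigma> -` (?T -` E)))"
      by (simp only: vim)
    also have "\<dots> = (\<Sum>f\<in>nb ` N. \<Sum>\<sigma> | \<sigma> \<in> N \<and> nb \<sigma> = f. word_ratio p \<sigma> * prob (nb \<sigma> -` (?T -` E)))"
      by (rule sum.image_gen[OF finN])
    also have "\<dots> = (\<Sum>f\<in>nb ` N. w f * prob (f -` (?T -` E)))"
      unfolding w_def sum_distrib_right by (intro sum.cong refl) auto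
    finally show "prob E = (\<Sum>f\<in>neighbour_set I r d K t {a..b}. w f * prob (f -` (?T -` E)))"
      by (simp only: V)
  qed
qed

text \<open>Both measures expand over the same functions \<open>f\<close>, with the same masses of
  the preimages of \<open>S\<close>; only the weights \<open>w\<close> and \<open>w'\<close>
  differ.\<close>

lemma neighbour_set_comparable:
  assumes "0 < t" "a < b" "0 < t'" "a' < b'"
    and eq: "neighbour_set I r d K t {a..b} = neighbour_set I r d K t' {a'..b'}"
  shows "\<exists>c>0. \<forall>S. S \<in> sets borel \<and> S \<subseteq> {0<..<1} \<longrightarrow>
    prob (interval_map {a'..b'} ` S) \<le> c * prob (interval_map {a..b} ` S)"
proof -
  let ?V = "neighbour_set I r d K t {a..b}"
  obtain w where w: "\<forall>f\<in>?V. 0 < w f"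
    "\<forall>E\<in>sets borel. E \<subseteq> {a<..<b} \<longrightarrow>
      prob E = (\<Sum>f\<in>?V. w f * prob (f -` (interval_map {a..b} -` E)))"
    using neighbour_set_measure[OF assms(1,2)] by blast
  obtain w' where w': "\<forall>f\<in>?V. 0 < w' f"
    "\<forall>E\<in>sets borel. E \<subseteq> {a'<..<b'} \<longrightarrow>
      prob E = (\<Sum>f\<in>?V. w' f * prob (f -` (interval_map {a'..b'} -` E)))"
    using neighbour_set_measure[OF assms(3,4)] unfolding eq by blast
  obtain c where c: "0 < c" "\<forall>m. (\<forall>f\<in>?V. 0 \<le> m f) \<longrightarrow>
      (\<Sum>f\<in>?V. w' f * m f) \<le> c * (\<Sum>f\<in>?V. w f * m f)"
    using finite_positive_weights_comparable[of ?V w w'] finite_neighbour_set[OF assms(1)] w(1) w'(1)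
    by blast
  have "prob (interval_map {a'..b'} ` S) \<le> c * prob (interval_map {a..b} ` S)"
    if S: "S \<in> sets borel" "S \<subseteq> {0<..<1}" for S
  proof -
    have sub: "interval_map {u..v} ` S \<subseteq> {u<..<v}" if "u < v" for u v
      using S(2) interval_map_vimage_Ioo[OF that] by blast
    have "prob (interval_map {a..b} ` S) = (\<Sum>f\<in>?V. w f * prob (f -` S))"
      using w(2)[rule_format, OF interval_map_image_borel[OF assms(2) S(1)] sub[OF assms(2)]]
      by (simp only: interval_map_vimage_image[OF assms(2)])
    moreover have "prob (interval_map {a'..b'} ` S) = (\<Sum>f\<in>?V. w' f * prob (f -` S))"
      using w'(2)[rule_format, OF interval_map_image_borel[OF assms(4) S(1)] sub[OF assms(4)]]
      by (simp only: interval_map_vimage_image[OF assms(4)])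
    ultimately show ?thesis
      using c(2)[rule_format, of "\<lambda>f. prob (f -` S)"] by simp
  qed
  then show ?thesis
    using c(1) by blast
qed

text \<open>Supplies the two boundary points that \<open>neighbour_set_K\<close> leaves out.\<close>

lemma vimage_Icc_K:
  assumes "a < b" "a \<in> K" "b \<in> K"
  shows "interval_map {a..b} -` ({a..b} \<inter> K) = insert 0 (insert 1 (interval_map {a..b} -` K \<inter> {0<..<1}))"
proof -
  have T: "interval_map {a..b} 0 = a" "interval_map {a..b} 1 = b"
    using assms(1) by (simp_all add: interval_map_Icc)
  have inj: "interval_map {a..b} x = a \<longleftrightarrow> x = 0" "interval_map {a..b} x = b \<longleftrightarrow> x = 1" for x
    using bij_is_inj[OF bij_interval_map_Icc[OF assms(1)]] T by (metis injD)+
  have "{a..b} \<inter> K = insert a (insert b (K \<inter> {a<..<b}))"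
    using assms by auto
  then show ?thesis
    using interval_map_vimage_Ioo[OF assms(1)] inj by auto
qed

section \<open>The similarity and the comparison of measures\<close>

lemma net_interval_similarity:
  assumes "0 < t" "0 < t'"
    and "\<Delta> \<in> net_intervals I r d K t" "\<Delta>' \<in> net_intervals I r d K t'"
    and eq: "neighbour_set I r d K t \<Delta> = neighbour_set I r d K t' \<Delta>'"
  shows "\<exists>g c\<^sub>1 c\<^sub>2.
    similarity_on (\<Delta> \<inter> K) g \<and> g ` (\<Delta> \<inter> K) = \<Delta>' \<inter> K \<and> 0 < c\<^sub>1 \<and> 0 < c\<^sub>2 \<and>
    (\<forall>E. E \<in> sets borel \<and> E \<subseteq> \<Delta> \<longrightarrow>
      c\<^sub>1 * prob E \<le> prob (g ` (E \<inter> K)) \<and> prob (g ` (E \<inter> K)) \<le> c\<^sub>2 * prob E)"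
proof -
  obtain a b where ab: "\<Delta> = {a..b}" "a < b" "a \<in> K" "b \<in> K"
    using net_intervalE[OF assms(3,1)] .
  obtain a' b' where ab': "\<Delta>' = {a'..b'}" "a' < b'" "a' \<in> K" "b' \<in> K"
    using net_intervalE[OF assms(4,2)] .
  define T T' where "T = interval_map {a..b}" and "T' = interval_map {a'..b'}"
  define g where "g = T' \<circ> inv T"
  \<comment> \<open>In this form, images under \<open>g\<close> depend only on the normalised set,
    and their measurability follows from that of \<open>T\<close> preimages and \<open>T'\<close>
    images.\<close>
  have g_image: "g ` X = T' ` (T -` X)" for X
    using bij_vimage_eq_inv_image[OF bij_interval_map_Icc[OF ab(2)], of X]
    by (simp add: g_def T_def image_image)
  \<comment> \<open>Both sides consist of \<open>0\<close>, \<open>1\<close> and the part in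
    \<open>{0<..<1}\<close> of the union of the sets \<open>f(K)\<close> over the common neighbour
    set.\<close>
  have "T -` (\<Delta> \<inter> K) = T' -` (\<Delta>' \<inter> K)"
    unfolding T_def T'_def ab(1) ab'(1) vimage_Icc_K[OF ab(2-4)] vimage_Icc_K[OF ab'(2-4)]
      neighbour_set_K[OF assms(1) ab(2)] neighbour_set_K[OF assms(2) ab'(2)]
      eq[unfolded ab(1) ab'(1)] ..
  then have surj: "g ` (\<Delta> \<inter> K) = \<Delta>' \<inter> K"
    by (simp only: g_image) (simp only: T'_def interval_map_image_vimage[OF ab'(2)])
  have sim: "similarity_on (\<Delta> \<inter> K) g"
    unfolding similarity_on_def
  \<comment> \<open>The factor is the ratio of the interval lengths, which are the slopes of
    \<open>T'\<close> and \<open>T\<close>.\<close>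
  proof (intro exI[of _ "(b' - a') / (b - a)"] conjI ballI)
    fix x y
    have "g x - g y = (b' - a') / (b - a) * (x - y)"
      by (simp add: g_def T_def T'_def inv_interval_map_Icc[OF ab(2)] interval_map_Icc[OF ab'(2)]
          algebra_simps diff_divide_distrib)
    then show "\<bar>g x - g y\<bar> = (b' - a') / (b - a) * \<bar>x - y\<bar>"
      using ab(2) ab'(2) by (simp add: abs_mult)
  qed (use ab(2) ab'(2) in simp)
  obtain c where c: "0 < c"
    "\<And>S. S \<in> sets borel \<Longrightarrow> S \<subseteq> {0<..<1} \<Longrightarrow> prob (T' ` S) \<le> c * prob (T ` S)"
    using neighbour_set_comparable[OF assms(1) ab(2) assms(2) ab'(2) eq[unfolded ab ab']]
    unfolding T_def T'_def by blast
  \<comment> \<open>The comparison with the roles exchanged; the inverse of its constant gives the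
    lower bound.\<close>
  obtain c' where c': "0 < c'"
    "\<And>S. S \<in> sets borel \<Longrightarrow> S \<subseteq> {0<..<1} \<Longrightarrow> prob (T ` S) \<le> c' * prob (T' ` S)"
    using neighbour_set_comparable[OF assms(2) ab'(2) assms(1) ab(2) eq[symmetric, unfolded ab ab']]
    unfolding T_def T'_def by blast
  have "1 / c' * prob E \<le> prob (g ` (E \<inter> K)) \<and> prob (g ` (E \<inter> K)) \<le> c * prob E"
    if E: "E \<in> sets borel" "E \<subseteq> \<Delta>" for E
  proof -
    have K: "K \<in> sets borel"
      using compact_K by (intro borel_closed compact_imp_closed)
    \<comment> \<open>Restricting to \<open>K\<close> and dropping the end points changes no mass
      and puts the normalised set \<open>S\<close> inside \<open>{0<..<1}\<close>, where the
      comparison applies.\<close>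
    define F where "F = E \<inter> K \<inter> {a<..<b}"
    define S where "S = T -` F"
    have F: "F \<in> sets borel"
      using E K by (auto simp: F_def)
    have S: "S \<in> sets borel" "S \<subseteq> {0<..<1}"
      using interval_map_vimage_borel[OF ab(2) F] interval_map_vimage_Ioo[OF ab(2)]
      by (auto simp: S_def T_def F_def)
    have TS: "T ` S = F"
      unfolding S_def T_def by (rule interval_map_image_vimage[OF ab(2)])
    have "prob E = prob (E \<inter> K)"
      using measure_Diff_null_set[OF _ null_outside_K, of E] E(1) by (simp add: Diff_Compl)
    also have "\<dots> = prob F"
      using E K F by (intro prob_eq_up_to_null[where X = "{a, b}"]) (auto simp: F_def ab)
    finally have "prob E = prob (T ` S)"
      by (simp add: TS)
    \<comment> \<open>The images of the dropped end points again form a finite, hence null,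
      set.\<close>
    moreover have "prob (g ` (E \<inter> K)) = prob (T' ` S)"
    proof (rule prob_eq_up_to_null[where X = "g ` {a, b}"])
      show "g ` (E \<inter> K) \<in> sets borel"
        unfolding g_image T_def T'_def
        by (intro interval_map_image_borel interval_map_vimage_borel sets.Int ab(2) ab'(2) E K)
      show "T' ` S \<in> sets borel"
        using S by (simp add: T'_def interval_map_image_borel ab')
      have "T' ` S = g ` F"
        by (simp add: S_def g_image)
      then show "T' ` S \<subseteq> g ` (E \<inter> K) \<union> g ` {a, b}"
        by (auto simp: F_def)
      have "E \<inter> K \<subseteq> F \<union> {a, b}"
        using E(2) by (auto simp: F_def ab)
      then show "g ` (E \<inter> K) \<subseteq> T' ` S \<union> g ` {a, b}"
        unfolding \<open>T' ` S = g ` F\<close> by blast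
    qed simp
    ultimately show ?thesis
      using c(2)[OF S] c'(2)[OF S] c'(1) by (simp add: field_simps)
  qed
  moreover have "0 < 1 / c'"
    using c'(1) by simp
  ultimately show ?thesis
    using sim surj c(1) by blast
qed

end

theorem lemma2p3:
  fixes I :: "'i set" and r d p :: "'i \<Rightarrow> real"
    and K :: "real set" and \<mu> :: "real measure"
    and t\<^sub>1 t\<^sub>2 :: real and \<Delta>\<^sub>1 \<Delta>\<^sub>2 :: "real set"
  assumes "is_ifs I r"
    and "is_attractor I r d K"
    and "\<nexists>x. K = {x}"
    and "convex hull K = {0..1}"
    and "is_prob_vector I p"
    and "is_self_similar_measure I r d p \<mu>"
    and "t\<^sub>1 > 0" and "t\<^sub>2 > 0"
    and "\<Delta>\<^sub>1 \<in> net_intervals I r d K t\<^sub>1"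
    and "\<Delta>\<^sub>2 \<in> net_intervals I r d K t\<^sub>2"
    and "neighbour_set I r d K t\<^sub>1 \<Delta>\<^sub>1 = neighbour_set I r d K t\<^sub>2 \<Delta>\<^sub>2"
  shows "\<exists>(g :: real \<Rightarrow> real) (c\<^sub>1 :: real) (c\<^sub>2 :: real).
           similarity_on (\<Delta>\<^sub>1 \<inter> K) g \<and> g ` (\<Delta>\<^sub>1 \<inter> K) = \<Delta>\<^sub>2 \<inter> K \<and> 0 < c\<^sub>1 \<and> 0 < c\<^sub>2 \<and>
           (\<forall>E. E \<in> sets borel \<and> E \<subseteq> \<Delta>\<^sub>1 \<longrightarrow>
              c\<^sub>1 * measure \<mu> E \<le> measure \<mu> (g ` (E \<inter> K)) \<and>
              measure \<mu> (g ` (E \<inter> K)) \<le> c\<^sub>2 * measure \<mu> E)"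
proof -
  interpret self_similar I r d K p \<mu>
    by unfold_locales (use assms in auto)
  show ?thesis
    by (rule net_interval_similarity) fact+
qed

end
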